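(* Let $P$ be a finite poset. For integers $i,j$ put $b(i,j,P)=|\{B\subseteq \operatorname{Min}P\mid |B|=i,\ d(P-B)=j\}|$ and $c(j,P)=\sum_{i=0}^{m(P)}(-1)^i b(i,j,P)$. Then for all nonnegative integers $m$, $$e(m,P)=\sum_{j=1}^{d(P)} c(j,P)\, j^m,\qquad\text{with } c(d(P),P)=1.$$ In particular, $\sum_{j=1}^{d(P)}c(j,P)=e(0,P)=0$ if $P$ is nonempty, and $\sum_{j=1}^{d(P)}c(j,P)\,j=e(1,P)=1$.
   Context: For a finite poset $P$ on $K$ and a finite set $M$ disjoint from $K$ with $|M|=m$, $e(m,P)$ is the number of partial orders on $M\cup K$ inducing $P$ on $K$ whose set of minimal elements is exactly $M$. $\operatorname{Min}P$ is the set of minimal elements of $P$, $m(P)=|\operatorname{Min}P|$, $d(\cdot)$ is the number of downsets of a finite poset, and $P-B$ is the subposet induced on $K\setminus B$. Convention $j^0=1$. *)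

theory Defs
  imports Main
begin

text \<open>
  A poset is represented by its reflexive order relation \<open>r\<close> with \<^term>\<open>Partial_order r\<close>; its ground
  set is \<^term>\<open>Field r\<close>, and the subposet induced on \<open>A\<close> is \<^term>\<open>Restr r A\<close>, whose
  field is \<open>A\<close> by reflexivity when \<^term>\<open>A \<subseteq> Field r\<close>.
\<close>

definition min_elems :: "'a rel \<Rightarrow> 'a set" where
  "min_elems r = {x \<in> Field r. \<forall>y. (y, x) \<in> r \<longrightarrow> y = x}"

definition downsets :: "'a rel \<Rightarrow> 'a set set" where
  "downsets r = {D. D \<subseteq> Field r \<and> (\<forall>x\<in>D. \<forall>y. (y, x) \<in> r \<longrightarrow> y \<in> D)}"

definition num_downsets :: "'a rel \<Rightarrow> nat" where
  "num_downsets r = card (downsets r)"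

definition delete_elems :: "'a rel \<Rightarrow> 'a set \<Rightarrow> 'a rel" where
  "delete_elems r B = Restr r (Field r - B)"

definition min_extensions :: "'a set \<Rightarrow> 'a rel \<Rightarrow> 'a rel set" where
  "min_extensions M r =
     {s. partial_order_on (M \<union> Field r) s \<and> Restr s (Field r) = r \<and> min_elems s = M}"

text \<open>
  The type \<open>'a\<close> need not contain \<open>m\<close> elements outside \<^term>\<open>Field r\<close>. The disjoint set of size
  \<open>m\<close> is therefore taken in the sum type; the choice is immaterial by
  \<open>card_min_extensions\<close> and \<open>card_min_extensions_disjoint\<close> below.
\<close>

definition num_min_extensions :: "nat \<Rightarrow> 'a rel \<Rightarrow> nat" where
  "num_min_extensions m r =
     card (min_extensions (Inl ` {..<m} :: (nat + 'a) set) (map_prod Inr Inr ` r))"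

definition b_num :: "int \<Rightarrow> int \<Rightarrow> 'a rel \<Rightarrow> nat" where
  "b_num i j r =
     card {B. B \<subseteq> min_elems r \<and> int (card B) = i \<and> int (num_downsets (delete_elems r B)) = j}"

definition c_coeff :: "int \<Rightarrow> 'a rel \<Rightarrow> int" where
  "c_coeff j r = (\<Sum>i = 0..card (min_elems r). (-1) ^ i * int (b_num (int i) j r))"


lemma Field_map_prod_image: "Field (map_prod g g ` r) = g ` Field r"
  by (force simp: Field_def)

lemma min_extensions_image:
  assumes inj: "inj_on g (M \<union> Field r)" and s: "s \<in> min_extensions M r"
  shows "map_prod g g ` s \<in> min_extensions (g ` M) (map_prod g g ` r)"
proof -
  let ?U = "M \<union> Field r"
  have po: "partial_order_on ?U s" and R: "Restr s (Field r) = r" and mn: "min_elems s = M"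
    using s by (auto simp: min_extensions_def)
  have sub: "s \<subseteq> ?U \<times> ?U" and rf: "\<And>x. x \<in> ?U \<Longrightarrow> (x, x) \<in> s" and tr: "trans s" and an: "antisym s"
    using po by (auto simp: order_on_defs refl_on_def)
  have F: "Field s = ?U"
    using sub rf unfolding Field_def[of s] by blast
  have mem: "(g x, g y) \<in> map_prod g g ` s \<longleftrightarrow> (x, y) \<in> s" if "x \<in> ?U" "y \<in> ?U" for x y
  proof
    assume "(g x, g y) \<in> map_prod g g ` s"
    then obtain x' y' where "(x', y') \<in> s" "g x = g x'" "g y = g y'" by auto
    moreover from this have "x' \<in> ?U" "y' \<in> ?U" using sub by blast+
    ultimately have "x = x'" "y = y'" using that inj_onD[OF inj] by simp_all
    then show "(x, y) \<in> s" using \<open>(x', y') \<in> s\<close> by simp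
  qed (rule map_prod_imageI)
  have rs: "(x, y) \<in> r \<longleftrightarrow> (x, y) \<in> s \<and> x \<in> Field r \<and> y \<in> Field r" for x y
    using arg_cong[OF R, of "\<lambda>q. (x, y) \<in> q"] by simp
  have sub': "map_prod g g ` s \<subseteq> g ` ?U \<times> g ` ?U"
  proof
    fix p assume "p \<in> map_prod g g ` s"
    then obtain x y where "p = (g x, g y)" "(x, y) \<in> s" by auto
    moreover from this have "x \<in> ?U" "y \<in> ?U" using sub by blast+
    ultimately show "p \<in> g ` ?U \<times> g ` ?U" by simp
  qed
  have tr': "trans (map_prod g g ` s)"
  proof (rule transI)
    fix x y z assume a: "(x, y) \<in> map_prod g g ` s" "(y, z) \<in> map_prod g g ` s"
    then have "x \<in> g ` ?U" "y \<in> g ` ?U" "z \<in> g ` ?U" using sub' by blast+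
    then obtain u v w where u: "u \<in> ?U" "v \<in> ?U" "w \<in> ?U" and e: "x = g u" "y = g v" "z = g w"
      by (elim imageE) simp
    then show "(x, z) \<in> map_prod g g ` s" using a mem[OF u(1,2)] mem[OF u(2,3)] mem[OF u(1,3)] tr
      by (metis transD)
  qed
  have an': "antisym (map_prod g g ` s)"
  proof (rule antisymI)
    fix x y assume a: "(x, y) \<in> map_prod g g ` s" "(y, x) \<in> map_prod g g ` s"
    then have "x \<in> g ` ?U" "y \<in> g ` ?U" using sub' by blast+
    then obtain u v where u: "u \<in> ?U" "v \<in> ?U" and e: "x = g u" "y = g v"
      by (elim imageE) simp
    then show "x = y" using a mem[OF u] mem[OF u(2,1)] an by (metis antisymD)
  qed
  have rf': "refl_on (g ` ?U) (map_prod g g ` s)"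
    using mem rf by (auto simp: refl_on_def simp del: map_prod_imageI)
  have "partial_order_on (g ` M \<union> g ` Field r) (map_prod g g ` s)"
    using sub' tr' an' rf' by (simp add: order_on_defs image_Un)
  moreover have "Restr (map_prod g g ` s) (g ` Field r) = map_prod g g ` r"
  proof (rule equalityI; rule subsetI)
    fix p assume "p \<in> Restr (map_prod g g ` s) (g ` Field r)"
    then obtain x y where p: "p = (g x, g y)" "x \<in> Field r" "y \<in> Field r" "p \<in> map_prod g g ` s"
      by blast
    then have "(x, y) \<in> r" using mem[of x y] rs[of x y] by simp
    then show "p \<in> map_prod g g ` r" unfolding p(1) by (rule map_prod_imageI)
  next
    fix p assume "p \<in> map_prod g g ` r"
    then obtain x y where p: "p = (g x, g y)" "(x, y) \<in> r" by auto
    then have "x \<in> Field r" "y \<in> Field r" "(x, y) \<in> s" using rs[of x y] by simp_all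
    then show "p \<in> Restr (map_prod g g ` s) (g ` Field r)"
      unfolding p(1) by (intro IntI SigmaI map_prod_imageI imageI)
  qed
  moreover have "min_elems (map_prod g g ` s) = g ` M"
  proof (rule equalityI; rule subsetI)
    fix z assume "z \<in> min_elems (map_prod g g ` s)"
    then have "z \<in> g ` ?U" and zm: "\<And>y. (y, z) \<in> map_prod g g ` s \<Longrightarrow> y = z"
      unfolding min_elems_def Field_map_prod_image F by blast+
    then obtain x where x: "z = g x" "x \<in> ?U" by blast
    have "y = x" if y: "(y, x) \<in> s" for y
    proof -
      have "y \<in> ?U" using y sub by blast
      then show ?thesis using zm[of "g y"] mem[of y x] x y inj_onD[OF inj, of y x] by blast
    qed
    then have "x \<in> min_elems s" using x by (auto simp: min_elems_def F)
    then show "z \<in> g ` M" using mn x by blast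
  next
    fix z assume "z \<in> g ` M"
    then obtain x where x: "z = g x" "x \<in> min_elems s" using mn by blast
    then have xU: "x \<in> ?U" and xm: "\<And>y. (y, x) \<in> s \<Longrightarrow> y = x" by (auto simp: min_elems_def F)
    have "y = z" if y: "(y, z) \<in> map_prod g g ` s" for y
    proof -
      obtain v where v: "y = g v" "v \<in> ?U" using y sub' by blast
      then have "v = x" using mem[of v x] xU x y xm by simp
      then show ?thesis using v x by simp
    qed
    then show "z \<in> min_elems (map_prod g g ` s)"
      unfolding min_elems_def Field_map_prod_image F using x xU by blast
  qed
  ultimately show ?thesis
    by (simp add: min_extensions_def Field_map_prod_image)
qed

lemma card_min_extensions_image:
  assumes inj: "inj_on g (M \<union> Field r)"
  shows "card (min_extensions (g ` M) (map_prod g g ` r)) = card (min_extensions M r)"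
proof -
  define h where "h = inv_into (M \<union> Field r) g"
  have hg: "h (g x) = x" if "x \<in> M \<union> Field r" for x
    using that inj by (simp add: h_def)
  have inv: "map_prod h h ` map_prod g g ` s = s" if "s \<subseteq> (M \<union> Field r) \<times> (M \<union> Field r)" for s
  proof -
    have "map_prod h h (map_prod g g p) = p" if "p \<in> s" for p
      using that \<open>s \<subseteq> _\<close> hg by (cases p) auto
    then show ?thesis by (simp add: image_image)
  qed
  have gh: "g (h y) = y" if "y \<in> g ` (M \<union> Field r)" for y
    using that hg by auto
  have inv': "map_prod g g ` map_prod h h ` t = t"
    if t: "t \<subseteq> g ` (M \<union> Field r) \<times> g ` (M \<union> Field r)" for t
  proof -
    have "map_prod g g (map_prod h h p) = p" if "p \<in> t" for p
    proof -
      obtain x y where p: "p = (x, y)" by (cases p)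
      then have "x \<in> g ` (M \<union> Field r)" "y \<in> g ` (M \<union> Field r)" using that t by blast+
      then show ?thesis using p gh by simp
    qed
    then show ?thesis by (simp add: image_image)
  qed
  have rsub: "r \<subseteq> (M \<union> Field r) \<times> (M \<union> Field r)" by (auto simp: Field_def)
  have hM: "h ` g ` M = M" using hg by (force simp: image_image)
  have injh: "inj_on h (g ` M \<union> Field (map_prod g g ` r))"
    by (rule inj_onI) (metis gh Field_map_prod_image image_Un)
  have "bij_betw ((`) (map_prod g g)) (min_extensions M r) (min_extensions (g ` M) (map_prod g g ` r))"
  proof (rule bij_betw_byWitness[where f' = "(`) (map_prod h h)"])
    show "\<forall>s\<in>min_extensions M r. map_prod h h ` map_prod g g ` s = s"
      using inv by (auto simp: min_extensions_def order_on_defs)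
    show "\<forall>t\<in>min_extensions (g ` M) (map_prod g g ` r). map_prod g g ` map_prod h h ` t = t"
    proof
      fix t assume "t \<in> min_extensions (g ` M) (map_prod g g ` r)"
      then have "t \<subseteq> g ` (M \<union> Field r) \<times> g ` (M \<union> Field r)"
        unfolding min_extensions_def order_on_defs Field_map_prod_image image_Un by blast
      then show "map_prod g g ` map_prod h h ` t = t" by (rule inv')
    qed
    show "(`) (map_prod g g) ` min_extensions M r \<subseteq> min_extensions (g ` M) (map_prod g g ` r)"
      using min_extensions_image[OF inj] by blast
    show "(`) (map_prod h h) ` min_extensions (g ` M) (map_prod g g ` r) \<subseteq> min_extensions M r"
      using min_extensions_image[OF injh] hM inv[OF rsub] by auto
  qed
  then show ?thesis by (simp add: bij_betw_same_card)
qed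

lemma card_min_extensions:
  fixes f :: "'a \<Rightarrow> 'b"
  assumes M: "finite M" "card M = m" and f: "inj_on f (Field r)" and disj: "M \<inter> f ` Field r = {}"
  shows "card (min_extensions M (map_prod f f ` r)) = num_min_extensions m r"
proof -
  obtain k where k: "bij_betw k {..<m} M"
    using M by (metis finite_lessThan card_lessThan finite_same_card_bij)
  define g :: "nat + 'a \<Rightarrow> 'b" where "g = case_sum k f"
  have F: "Field (map_prod Inr Inr ` r :: (nat + 'a) rel) = Inr ` Field r"
    by (rule Field_map_prod_image)
  have ne: "k a \<noteq> f b" if "a < m" "b \<in> Field r" for a b
    using that bij_betwE[OF k] disj by (metis disjoint_iff imageI lessThan_iff)
  have "inj_on g (Inl ` {..<m} \<union> Inr ` Field r)"
  proof (rule inj_onI)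
    fix x y
    assume "x \<in> Inl ` {..<m} \<union> Inr ` Field r" "y \<in> Inl ` {..<m} \<union> Inr ` Field r" "g x = g y"
    then show "x = y"
      using bij_betw_imp_inj_on[OF k] f ne ne[symmetric]
      by (cases x; cases y) (auto simp: g_def dest: inj_onD)
  qed
  moreover have "g ` Inl ` {..<m} = M"
    using k by (simp add: g_def image_image bij_betw_def)
  moreover have "map_prod g g ` map_prod Inr Inr ` r = map_prod f f ` r"
    by (simp add: image_image g_def map_prod_def case_prod_unfold)
  ultimately show ?thesis
    using card_min_extensions_image[of g "Inl ` {..<m}" "map_prod Inr Inr ` r"]
    by (simp add: F num_min_extensions_def)
qed

corollary card_min_extensions_disjoint:
  assumes "finite M" "card M = m" "M \<inter> Field r = {}"
  shows "card (min_extensions M r) = num_min_extensions m r"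
  using card_min_extensions[of M m "\<lambda>x. x" r] assms by (simp add: map_prod_def)

end

theory Submission
  imports Defs "HOL-Library.FuncSet"
begin

text \<open>
  An extension whose set of minimal elements is \<open>M\<close> amounts to a family of downsets \<open>F x\<close> of \<open>P\<close>,
  \<open>x \<in> M\<close>, where \<open>F x\<close> consists of the elements of \<open>P\<close> not above \<open>x\<close>; the elements of \<open>P\<close>
  cease to be minimal exactly if no minimal element of \<open>P\<close> lies in all the \<open>F x\<close>. Inclusion-exclusion
  over the sets \<open>B \<subseteq> Min P\<close> contained in all the \<open>F x\<close> counts these families, because
  the downsets containing \<open>B\<close> correspond to the downsets of \<open>P - B\<close>. Grouping the sets \<open>B\<close> by
  \<open>d(P - B)\<close> yields the formula.
\<close>

section \<open>Downsets after deleting minimal elements\<close>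

text \<open>The inverse adds \<open>B\<close> back. This keeps a set down-closed because nothing
  lies strictly below an element of \<open>B\<close>, and whatever lies below the remaining elements
  is in \<open>D\<close> or in \<open>B\<close>.\<close>

lemma downsets_delete_elems:
  assumes "Partial_order r" and "B \<subseteq> min_elems r"
  shows "bij_betw (\<lambda>D. D - B) {D \<in> downsets r. B \<subseteq> D} (downsets (delete_elems r B))"
proof -
  have refl: "(x, x) \<in> r" if "x \<in> Field r" for x
    using assms(1) that by (auto simp: order_on_defs refl_on_def)
  have BF: "B \<subseteq> Field r" using assms(2) by (auto simp: min_elems_def)
  have Bmin: "y = x" if "x \<in> B" "(y, x) \<in> r" for x y
    using assms(2) that by (auto simp: min_elems_def)
  have F: "Field (delete_elems r B) = Field r - B"
    using refl by (auto simp: delete_elems_def Field_def)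
  have mem: "(y, x) \<in> delete_elems r B \<longleftrightarrow> (y, x) \<in> r \<and> y \<notin> B \<and> x \<notin> B" for x y
    by (auto simp: delete_elems_def Field_def)
  have into: "D - B \<in> downsets (delete_elems r B)" if "D \<in> downsets r" for D
    using that unfolding downsets_def F mem by blast
  have out: "D \<union> B \<in> downsets r" if "D \<in> downsets (delete_elems r B)" for D
    unfolding downsets_def
  proof (intro CollectI conjI ballI allI impI)
    show "D \<union> B \<subseteq> Field r" using that BF unfolding downsets_def F by blast
    fix x y assume "x \<in> D \<union> B" "(y, x) \<in> r"
    then show "y \<in> D \<union> B"
      using that Bmin[of x y] unfolding downsets_def F mem by blast
  qed
  show ?thesis
  proof (rule bij_betw_byWitness[where f' = "\<lambda>D. D \<union> B"])
    show "\<forall>D\<in>downsets (delete_elems r B). (D \<union> B) - B = D"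
      unfolding downsets_def F by blast
  qed (use into out in auto)
qed

lemma num_downsets_delete_elems:
  assumes "Partial_order r" and "B \<subseteq> min_elems r"
  shows "num_downsets (delete_elems r B) = card {D \<in> downsets r. B \<subseteq> D}"
  using bij_betw_same_card[OF downsets_delete_elems[OF assms]] by (simp add: num_downsets_def)

lemma finite_downsets: "finite (Field r) \<Longrightarrow> finite (downsets r)"
  by (rule finite_subset[of _ "Pow (Field r)"]) (auto simp: downsets_def)

lemma empty_in_downsets: "{} \<in> downsets r"
  by (simp add: downsets_def)

lemma Field_in_downsets: "Field r \<in> downsets r"
  by (auto simp: downsets_def Field_def)

lemma finite_min_elems: "finite (Field r) \<Longrightarrow> finite (min_elems r)"
  by (rule finite_subset[of _ "Field r"]) (auto simp: min_elems_def)

text \<open>By finiteness \<open>D\<close> has a minimal element of its own; everything below it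
  lies in \<open>D\<close> again, so it is minimal in the whole poset.\<close>

lemma downset_contains_min_elem:
  assumes "Partial_order r" and "finite (Field r)" and "D \<in> downsets r" and "D \<noteq> {}"
  shows "D \<inter> min_elems r \<noteq> {}"
proof -
  have "r \<subseteq> Field r \<times> Field r" by (auto simp: Field_def)
  then have "finite r" using assms(2) by (simp add: finite_subset)
  then have "wf (r - Id)" using assms(1) by (rule partial_order_on_well_order_on)
  then obtain z where "z \<in> D" "\<And>y. (y, z) \<in> r - Id \<Longrightarrow> y \<notin> D"
    using assms(4) by (metis wf_eq_minimal ex_in_conv)
  moreover from this have "y = z" if "(y, z) \<in> r" for y
    using that assms(3) by (auto simp: downsets_def)
  ultimately show ?thesis using assms(3) by (auto simp: downsets_def min_elems_def)
qed

text \<open>Expansion of the product of \<open>1 - 1\<close> over \<open>A\<close>, which is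
  \<open>0 ^ card A\<close>.\<close>

lemma sum_Pow_alternating:
  "finite A \<Longrightarrow> (\<Sum>B\<in>Pow A. (-1) ^ card B) = (if A = {} then 1 else (0::int))"
  using prod_diff_conv_sum[of A "\<lambda>_. 1" "\<lambda>_. 1::int"] by (simp add: power_0_left)

section \<open>Extensions as families of downsets\<close>

text \<open>The complements of the \<open>F i\<close> cover the minimal elements. For
  \<open>m = 0\<close> the condition says that there are no minimal elements. The extensional
  function space makes a family determined by its values below \<open>m\<close>, so that counting is
  meaningful.\<close>

definition covering_families :: "nat \<Rightarrow> 'a rel \<Rightarrow> (nat \<Rightarrow> 'a set) set" where
  "covering_families m r =
     {F \<in> {..<m} \<rightarrow>\<^sub>E downsets r. {p \<in> min_elems r. \<forall>i<m. p \<in> F i} = {}}"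

definition extension_of_family :: "nat \<Rightarrow> 'a rel \<Rightarrow> (nat \<Rightarrow> 'a set) \<Rightarrow> (nat + 'a) rel" where
  "extension_of_family m r F =
     map_prod Inr Inr ` r \<union> (\<lambda>i. (Inl i, Inl i)) ` {..<m}
       \<union> {(Inl i, Inr y) | i y. i < m \<and> y \<in> Field r - F i}"

lemma extension_of_family_iff:
  "(Inr x, Inr y) \<in> extension_of_family m r F \<longleftrightarrow> (x, y) \<in> r"
  "(Inl i, Inl j) \<in> extension_of_family m r F \<longleftrightarrow> i = j \<and> i < m"
  "(Inl i, Inr y) \<in> extension_of_family m r F \<longleftrightarrow> i < m \<and> y \<in> Field r - F i"
  "(Inr y, Inl i) \<notin> extension_of_family m r F"
  by (auto simp: extension_of_family_def)

lemma sum_rel_eqI: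
  assumes "\<And>i j. (Inl i, Inl j) \<in> s \<longleftrightarrow> (Inl i, Inl j) \<in> t"
    and "\<And>i y. (Inl i, Inr y) \<in> s \<longleftrightarrow> (Inl i, Inr y) \<in> t"
    and "\<And>x j. (Inr x, Inl j) \<in> s \<longleftrightarrow> (Inr x, Inl j) \<in> t"
    and "\<And>x y. (Inr x, Inr y) \<in> s \<longleftrightarrow> (Inr x, Inr y) \<in> t"
  shows "s = t"
proof (rule set_eqI)
  fix p show "p \<in> s \<longleftrightarrow> p \<in> t"
    using assms by (cases p; cases "fst p"; cases "snd p") auto
qed

text \<open>Transitivity rests on the complement of each \<open>F i\<close> being up-closed. A
  minimal element of \<open>r\<close> gets a new element below it by the covering condition; any
  other element already has an old one.\<close>

lemma extension_of_family_in_min_extensions: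
  assumes po: "Partial_order r" and F: "F \<in> covering_families m r"
  shows "extension_of_family m r F \<in> min_extensions (Inl ` {..<m}) (map_prod Inr Inr ` r)"
    (is "?s \<in> _")
proof -
  note iff = extension_of_family_iff
  have refl: "\<And>x. x \<in> Field r \<Longrightarrow> (x, x) \<in> r" and tr: "trans r" and an: "antisym r"
    using po by (auto simp: order_on_defs refl_on_def)
  have down: "F i \<in> downsets r" if "i < m" for i
    using F that by (auto simp: covering_families_def)
  let ?U = "Inl ` {..<m} \<union> Inr ` Field r"
  have sub: "?s \<subseteq> ?U \<times> ?U"
    by (auto simp: extension_of_family_def Field_def)
  have rf: "\<And>z. z \<in> ?U \<Longrightarrow> (z, z) \<in> ?s"
    using refl by (auto simp: iff)
  have FU: "Field ?s = ?U"
    using sub rf unfolding Field_def[of ?s] by blast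
  have above: "z \<in> Field r - F i" if "i < m" "y \<in> Field r - F i" "(y, z) \<in> r" for i y z
    using down[OF that(1)] that(2,3) unfolding downsets_def by (blast intro: FieldI2)
  have "trans ?s"
  proof (rule transI)
    fix x y z assume xy: "(x, y) \<in> ?s" and yz: "(y, z) \<in> ?s"
    show "(x, z) \<in> ?s"
    proof (cases y)
      \<comment> \<open>Only the loop ends in a new element, so the first pair is trivial.\<close>
      case (Inl i)
      then have "x = y" using xy by (cases x) (auto simp: iff)
      then show ?thesis using yz by simp
    next
      case (Inr b)
      then obtain c where c: "z = Inr c" "(b, c) \<in> r" using yz by (cases z) (auto simp: iff)
      show ?thesis
      proof (cases x)
        case (Inl i)
        then show ?thesis using xy c above[of i b c] \<open>y = Inr b\<close> by (simp add: iff)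
      next
        case (Inr a)
        then show ?thesis using xy c transD[OF tr, of a b c] \<open>y = Inr b\<close> by (simp add: iff)
      qed
    qed
  qed
  moreover have "antisym ?s"
  proof (rule antisymI)
    fix x y assume "(x, y) \<in> ?s" "(y, x) \<in> ?s"
    then show "x = y" using an by (cases x; cases y) (auto simp: iff dest: antisymD)
  qed
  ultimately have "partial_order_on ?U ?s"
    using sub rf by (simp add: order_on_defs refl_on_def)
  moreover have "Restr ?s (Inr ` Field r) = map_prod Inr Inr ` r"
    by (auto simp: extension_of_family_def Field_def)
  moreover have "min_elems ?s = Inl ` {..<m}"
  proof (rule set_eqI)
    fix z show "z \<in> min_elems ?s \<longleftrightarrow> z \<in> Inl ` {..<m}"
    proof (cases z)
      case (Inl i)
      have "w = Inl i" if "(w, Inl i) \<in> ?s" for w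
        using that by (cases w) (auto simp: iff)
      then show ?thesis using Inl by (auto simp: min_elems_def FU)
    next
      case (Inr y)
      have "\<exists>w. (w, Inr y) \<in> ?s \<and> w \<noteq> Inr y" if y: "y \<in> Field r"
      proof (cases "y \<in> min_elems r")
        case True
        then obtain i where "i < m" "y \<notin> F i" using F by (auto simp: covering_families_def)
        then show ?thesis using y by (intro exI[of _ "Inl i"]) (simp add: iff)
      next
        case False
        then obtain x where "(x, y) \<in> r" "x \<noteq> y" using y by (auto simp: min_elems_def)
        then show ?thesis by (intro exI[of _ "Inr x"]) (simp add: iff)
      qed
      then show ?thesis using Inr by (auto simp: min_elems_def FU)
    qed
  qed
  ultimately show ?thesis by (simp add: min_extensions_def Field_map_prod_image)
qed

text \<open>The converse: as the new elements are minimal and \<open>s\<close> agrees with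
  \<open>r\<close> on the old ones, the only freedom in \<open>s\<close> is which old elements lie
  above which new ones, and \<open>F\<close> records this.\<close>

lemma family_of_min_extension:
  assumes s: "s \<in> min_extensions (Inl ` {..<m}) (map_prod Inr Inr ` r)"
  defines "F \<equiv> \<lambda>i\<in>{..<m}. {y \<in> Field r. (Inl i, Inr y) \<notin> s}"
  shows "F \<in> covering_families m r" and "extension_of_family m r F = s"
proof -
  let ?U = "Inl ` {..<m} \<union> Inr ` Field r"
  have po: "partial_order_on ?U s" and R: "Restr s (Inr ` Field r) = map_prod Inr Inr ` r"
    and mn: "min_elems s = Inl ` {..<m}"
    using s by (auto simp: min_extensions_def Field_map_prod_image)
  have sub: "s \<subseteq> ?U \<times> ?U" and rf: "\<And>x. x \<in> ?U \<Longrightarrow> (x, x) \<in> s" and tr: "trans s"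
    using po by (auto simp: order_on_defs refl_on_def)
  have FU: "Field s = ?U"
    using sub rf unfolding Field_def[of s] by blast
  have rs: "(Inr x, Inr y) \<in> s \<longleftrightarrow> (x, y) \<in> r" for x y
  proof -
    have "(x, y) \<in> r \<longleftrightarrow> (Inr x, Inr y) \<in> Restr s (Inr ` Field r)"
      unfolding R by auto
    then show ?thesis using sub by blast
  qed
  \<comment> \<open>This settles all pairs ending in a new element.\<close>
  have low: "z = Inl i" if "(z, Inl i) \<in> s" for z i
  proof -
    have "Inl i \<in> min_elems s" using that sub mn by blast
    then show ?thesis using that by (simp add: min_elems_def)
  qed
  have "F i \<in> downsets r" if "i < m" for i
    unfolding downsets_def
  proof (intro CollectI conjI ballI allI impI)
    show "F i \<subseteq> Field r" using that by (auto simp: F_def)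
    fix x y assume "x \<in> F i" "(y, x) \<in> r"
    then show "y \<in> F i"
      using that transD[OF tr, of "Inl i" "Inr y" "Inr x"] rs[of y x]
      by (auto simp: F_def intro: FieldI1)
  qed
  moreover have "\<exists>i<m. p \<notin> F i" if p: "p \<in> min_elems r" for p
  proof -
    \<comment> \<open>\<open>Inr p\<close> is not minimal in \<open>s\<close>, and no old element
      lies strictly below \<open>p\<close>; hence a new one does.\<close>
    have "Inr p \<in> Field s" using p by (auto simp: FU min_elems_def)
    moreover have "Inr p \<notin> min_elems s" by (auto simp: mn)
    ultimately obtain z where z: "(z, Inr p) \<in> s" "z \<noteq> Inr p" by (auto simp: min_elems_def)
    show ?thesis
    proof (cases z)
      case (Inl i)
      then have "i < m" using z sub by blast
      then show ?thesis using z Inl by (auto simp: F_def)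
    next
      case (Inr x)
      then show ?thesis using z p rs by (auto simp: min_elems_def)
    qed
  qed
  ultimately show "F \<in> covering_families m r"
    by (auto simp: covering_families_def F_def)
  show "extension_of_family m r F = s"
  proof (rule sum_rel_eqI)
    fix i j
    show "(Inl i, Inl j) \<in> extension_of_family m r F \<longleftrightarrow> (Inl i, Inl j) \<in> s"
      using low[of "Inl i" j] rf[of "Inl i"] sub by (auto simp: extension_of_family_iff)
  next
    fix i y
    have "(Inl i, Inr y) \<in> s \<Longrightarrow> i < m \<and> y \<in> Field r" using sub by blast
    then show "(Inl i, Inr y) \<in> extension_of_family m r F \<longleftrightarrow> (Inl i, Inr y) \<in> s"
      by (auto simp: extension_of_family_iff F_def)
  next
    fix x j
    show "(Inr x, Inl j) \<in> extension_of_family m r F \<longleftrightarrow> (Inr x, Inl j) \<in> s"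
      using low[of "Inr x" j] by (auto simp: extension_of_family_iff)
  qed (simp add: extension_of_family_iff rs)
qed

lemma num_min_extensions_eq_card_covering_families:
  assumes "Partial_order r"
  shows "num_min_extensions m r = card (covering_families m r)"
proof -
  have "bij_betw (extension_of_family m r) (covering_families m r)
          (min_extensions (Inl ` {..<m}) (map_prod Inr Inr ` r))"
  proof (rule bij_betw_byWitness[where f' = "\<lambda>s. \<lambda>i\<in>{..<m}. {y \<in> Field r. (Inl i, Inr y) \<notin> s}"])
    show "\<forall>F\<in>covering_families m r.
        (\<lambda>i\<in>{..<m}. {y \<in> Field r. (Inl i, Inr y) \<notin> extension_of_family m r F}) = F"
    proof
      fix F assume F: "F \<in> covering_families m r"
      then have PiE: "F \<in> {..<m} \<rightarrow>\<^sub>E downsets r" by (simp add: covering_families_def)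
      show "(\<lambda>i\<in>{..<m}. {y \<in> Field r. (Inl i, Inr y) \<notin> extension_of_family m r F}) = F"
      proof
        fix i
        show "(\<lambda>i\<in>{..<m}. {y \<in> Field r. (Inl i, Inr y) \<notin> extension_of_family m r F}) i = F i"
        \<comment> \<open>Below \<open>m\<close>, complementing twice returns \<open>F i\<close>
          because \<open>F i \<subseteq> Field r\<close>; elsewhere both sides are
          \<open>undefined\<close>.\<close>
        proof (cases "i < m")
          case True
          then have "F i \<subseteq> Field r" using PiE_mem[OF PiE, of i] by (simp add: downsets_def)
          then show ?thesis using True by (auto simp: extension_of_family_iff)
        qed (simp add: PiE_arb[OF PiE])
      qed
    qed
  qed (use extension_of_family_in_min_extensions[OF assms] family_of_min_extension in \<open>blast+\<close>)
  then show ?thesis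
    by (simp add: num_min_extensions_def bij_betw_same_card)
qed

section \<open>Inclusion-exclusion\<close>

lemma num_min_extensions_inclusion_exclusion:
  assumes po: "Partial_order r" and fin: "finite (Field r)"
  shows "int (num_min_extensions m r)
    = (\<Sum>B\<in>Pow (min_elems r). (-1) ^ card B * int (num_downsets (delete_elems r B)) ^ m)"
proof -
  let ?P = "{..<m} \<rightarrow>\<^sub>E downsets r" and ?M = "min_elems r"
  \<comment> \<open>The minimal elements of \<open>r\<close> below which the family puts no new
    element; exactly the families with \<open>?S F\<close> empty are to be counted.\<close>
  let ?S = "\<lambda>F. {p \<in> ?M. \<forall>i<m. p \<in> F i}"
  have finP: "finite ?P" using finite_downsets[OF fin] by (simp add: finite_PiE)
  have finM: "finite ?M" using fin by (rule finite_min_elems)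
  have "(-1) ^ card B * int (num_downsets (delete_elems r B)) ^ m
      = (\<Sum>F\<in>?P. if B \<subseteq> ?S F then (-1) ^ card B else 0)" if "B \<in> Pow ?M" for B
  proof -
    have B: "B \<subseteq> ?M" using that by simp
    \<comment> \<open>The condition splits over the coordinates, which produces the
      \<open>m\<close>-th power. For \<open>m = 0\<close> both sides consist of the one empty
      family, in accordance with \<open>j ^ 0 = 1\<close>.\<close>
    have "{F \<in> ?P. B \<subseteq> ?S F} = {..<m} \<rightarrow>\<^sub>E {D \<in> downsets r. B \<subseteq> D}"
      using B unfolding PiE_iff set_eq_iff mem_Collect_eq subset_iff lessThan_iff by blast
    then have "card {F \<in> ?P. B \<subseteq> ?S F} = num_downsets (delete_elems r B) ^ m"
      by (simp add: card_PiE num_downsets_delete_elems[OF po B])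
    then show ?thesis
      using finP by (simp flip: sum.inter_filter)
  qed
  then have "(\<Sum>B\<in>Pow ?M. (-1) ^ card B * int (num_downsets (delete_elems r B)) ^ m)
      = (\<Sum>B\<in>Pow ?M. \<Sum>F\<in>?P. if B \<subseteq> ?S F then (-1) ^ card B else 0)"
    by (rule sum.cong[OF refl])
  also have "\<dots> = (\<Sum>F\<in>?P. \<Sum>B\<in>Pow ?M. if B \<subseteq> ?S F then (-1) ^ card B else 0)"
    by (rule sum.swap)
  also have "\<dots> = (\<Sum>F\<in>?P. if ?S F = {} then 1 else 0)"
  proof (rule sum.cong[OF refl])
    fix F
    have "(\<Sum>B\<in>Pow ?M. if B \<subseteq> ?S F then (-1) ^ card B else 0 :: int)
        = (\<Sum>B\<in>{B \<in> Pow ?M. B \<subseteq> ?S F}. (-1) ^ card B)"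
      using finM by (simp only: sum.inter_filter finite_Pow_iff)
    \<comment> \<open>For a fixed family the signs run over all subsets of \<open>?S F\<close>, so
      they cancel unless it is empty.\<close>
    also have "{B \<in> Pow ?M. B \<subseteq> ?S F} = Pow (?S F)" by blast
    also have "(\<Sum>B\<in>Pow (?S F). (-1) ^ card B :: int) = (if ?S F = {} then 1 else 0)"
      using finM by (intro sum_Pow_alternating) simp
    finally show "(\<Sum>B\<in>Pow ?M. if B \<subseteq> ?S F then (-1) ^ card B else 0 :: int)
        = (if ?S F = {} then 1 else 0)" .
  qed
  also have "\<dots> = int (card {F \<in> ?P. ?S F = {}})"
    using finP by (simp flip: sum.inter_filter)
  finally show ?thesis
    by (simp add: num_min_extensions_eq_card_covering_families[OF po] covering_families_def)
qed

section \<open>The coefficients and their range\<close>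

text \<open>Merges the counts by size into one signed sum over sets, the form in which the
  coefficient appears once inclusion-exclusion is grouped by \<open>j\<close>.\<close>

lemma c_coeff_eq_sum:
  assumes "finite (Field r)"
  shows "c_coeff j r
    = (\<Sum>B\<in>{B \<in> Pow (min_elems r). int (num_downsets (delete_elems r B)) = j}. (-1) ^ card B)"
    (is "_ = sum _ ?A")
proof -
  have fin: "finite (min_elems r)" using assms by (rule finite_min_elems)
  have "(\<Sum>B\<in>?A. (-1) ^ card B :: int)
      = (\<Sum>i\<in>{0..card (min_elems r)}. \<Sum>B\<in>{B \<in> ?A. card B = i}. (-1) ^ card B)"
    using fin by (intro sum.group[symmetric]) (auto intro: card_mono)
  also have "\<dots> = c_coeff j r"
    unfolding c_coeff_def
  proof (rule sum.cong[OF refl])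
    fix i
    have "{B \<in> ?A. card B = i}
      = {B. B \<subseteq> min_elems r \<and> int (card B) = int i \<and> int (num_downsets (delete_elems r B)) = j}"
      by auto
    then show "(\<Sum>B\<in>{B \<in> ?A. card B = i}. (-1) ^ card B) = (-1) ^ i * int (b_num (int i) j r)"
      by (simp add: b_num_def flip: sum_distrib_right)
  qed
  finally show ?thesis by simp
qed

text \<open>Count the downsets of \<open>r\<close> containing \<open>B\<close> instead: the whole
  field is always one of them, and the empty downset is lost as soon as \<open>B\<close> is
  nonempty. The bounds give the range of \<open>j\<close>, the equality case the top
  coefficient.\<close>

lemma num_downsets_delete_elems_bounds:
  assumes "Partial_order r" and "finite (Field r)" and "B \<subseteq> min_elems r"
  shows "1 \<le> num_downsets (delete_elems r B)"
    and "num_downsets (delete_elems r B) \<le> num_downsets r"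
    and "num_downsets (delete_elems r B) = num_downsets r \<longleftrightarrow> B = {}"
proof -
  let ?D = "{D \<in> downsets r. B \<subseteq> D}"
  note eq = num_downsets_delete_elems[OF assms(1,3)]
  note fin = finite_downsets[OF assms(2)]
  have "Field r \<in> ?D" using assms(3) Field_in_downsets by (auto simp: min_elems_def)
  then have "card ?D \<noteq> 0" using fin by auto
  then show "1 \<le> num_downsets (delete_elems r B)" by (simp add: eq)
  show "num_downsets (delete_elems r B) \<le> num_downsets r"
    unfolding eq unfolding num_downsets_def using fin by (simp add: card_mono)
  have "card ?D < card (downsets r)" if "B \<noteq> {}"
  proof (rule psubset_card_mono[OF fin])
    show "?D \<subset> downsets r" using that empty_in_downsets by blast
  qed
  then show "num_downsets (delete_elems r B) = num_downsets r \<longleftrightarrow> B = {}"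
    unfolding eq unfolding num_downsets_def by (cases "B = {}") auto
qed

section \<open>The values at 0 and 1\<close>

text \<open>With no new elements nothing can cover the minimal elements, and a nonempty finite poset
  has some.\<close>

lemma num_min_extensions_0:
  assumes "Partial_order r" and "finite (Field r)" and "Field r \<noteq> {}"
  shows "num_min_extensions 0 r = 0"
proof -
  have "min_elems r \<noteq> {}"
    using downset_contains_min_elem[OF assms(1,2) Field_in_downsets assms(3)] by blast
  then show ?thesis
    by (simp add: num_min_extensions_eq_card_covering_families[OF assms(1)] covering_families_def)
qed

text \<open>The single downset must avoid every minimal element, hence is empty: the new element
  lies below everything.\<close>

lemma num_min_extensions_1:
  assumes "Partial_order r" and "finite (Field r)"
  shows "num_min_extensions 1 r = 1"
proof -
  have "{p \<in> min_elems r. p \<in> D} = {} \<longleftrightarrow> D = {}" if "D \<in> downsets r" for D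
    using downset_contains_min_elem[OF assms that] by blast
  then have "F \<in> covering_families 1 r \<longleftrightarrow> F \<in> {..<1} \<rightarrow>\<^sub>E {{}}" for F
    unfolding covering_families_def PiE_iff mem_Collect_eq using empty_in_downsets[of r] by auto
  then have "covering_families 1 r = {..<1} \<rightarrow>\<^sub>E {{}}" by (intro set_eqI)
  then show ?thesis
    by (simp add: num_min_extensions_eq_card_covering_families[OF assms(1)] card_PiE)
qed

theorem theorem4p3:
  fixes r :: "'a rel"
  assumes "Partial_order r" and "finite (Field r)"
  shows "(\<forall>m::nat. int (num_min_extensions m r)
            = (\<Sum>j = 1..int (num_downsets r). c_coeff j r * j ^ m))
       \<and> c_coeff (int (num_downsets r)) r = 1
       \<and> (Field r \<noteq> {} \<longrightarrow>
            (\<Sum>j = 1..int (num_downsets r). c_coeff j r) = int (num_min_extensions 0 r)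
            \<and> num_min_extensions 0 r = 0)
       \<and> (\<Sum>j = 1..int (num_downsets r). c_coeff j r * j) = int (num_min_extensions 1 r)
       \<and> num_min_extensions 1 r = 1"
proof -
  let ?d = "\<lambda>B. int (num_downsets (delete_elems r B))"
  note bounds = num_downsets_delete_elems_bounds[OF assms]
  have main: "int (num_min_extensions m r) = (\<Sum>j = 1..int (num_downsets r). c_coeff j r * j ^ m)" for m
  proof -
    \<comment> \<open>Every \<open>B\<close> falls into one of the groups, so grouping by
      \<open>?d B\<close> loses no term.\<close>
    have "?d ` Pow (min_elems r) \<subseteq> {1..int (num_downsets r)}"
      using bounds(1,2) by fastforce
    then have "int (num_min_extensions m r)
        = (\<Sum>j = 1..int (num_downsets r). \<Sum>B\<in>{B \<in> Pow (min_elems r). ?d B = j}. (-1) ^ card B * ?d B ^ m)"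
      unfolding num_min_extensions_inclusion_exclusion[OF assms]
      using finite_min_elems[OF assms(2)] by (intro sum.group[symmetric]) auto
    also have "\<dots> = (\<Sum>j = 1..int (num_downsets r). c_coeff j r * j ^ m)"
      by (intro sum.cong refl) (simp add: c_coeff_eq_sum[OF assms(2)] sum_distrib_right)
    finally show ?thesis .
  qed
  \<comment> \<open>Only the empty set attains the top value, and its sign is
    \<open>(-1) ^ 0\<close>.\<close>
  have "{B \<in> Pow (min_elems r). ?d B = int (num_downsets r)} = {{}}"
    using bounds(3) by auto
  then have "c_coeff (int (num_downsets r)) r = 1"
    by (simp add: c_coeff_eq_sum[OF assms(2)])
  then show ?thesis
    using main[of 0] main[of 1] num_min_extensions_0[OF assms] num_min_extensions_1[OF assms]
    by (intro conjI allI impI main) simp_all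
qed

end
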